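(* Let $n,m\ge 1$, $\mathcal{Z}=\Delta_n\times\Delta_m$, and let $f:\Delta_n\times\Delta_m\to\mathbb{R}$ be differentiable, convex in its first argument and concave in its second, with nonempty set of saddle points $\mathcal{Z}^\star$ and with saddle operator $G$ that is $L$-Lipschitz on $\mathcal{Z}$. Let $(z_t,z'_t)_{t\ge 0}$ be generated by Optimistic Multiplicative-Weights Update (OMWU) with constant learning rate $\eta$ satisfying $0<\eta<\frac{1}{3L}$ and with initialization $z_0,z'_0\in\operatorname{ri}\mathcal{Z}$. Then there exists $\bar z\in\mathcal{Z}^\star$ such that $$z_t\to\bar z\qquad\text{and}\qquad z'_t\to\bar z .$$
   Context: $\Delta_d=\{p\in\mathbb{R}^d_{\ge 0}:\sum_{i=1}^d p_i=1\}$, and $\operatorname{ri}$ denotes relative interior (so $\operatorname{ri}\mathcal{Z}$ is the set of points of $\mathcal Z$ with all coordinates strictly positive). Points of $\mathcal{Z}=\Delta_n\times\Delta_m$ are written $z=(x,y)$. Saddle points: $z^\star=(x^\star,y^\star)\in\mathcal{Z}$ is a saddle point if $f(x^\star,y)\le f(x^\star,y^\star)\le f(x,y^\star)$ for all $(x,y)\in\mathcal{Z}$; $\mathcal{Z}^\star$ is the set of saddle points. Saddle operator: $G(z)=(\nabla_x f(x,y),-\nabla_y f(x,y))$. The norm is $\|z\|=\sqrt{\|x\|_1^2+\|y\|_1^2}$, with dual norm $\|(a,b)\|_\star=\sqrt{\|a\|_\infty^2+\|b\|_\infty^2}$. "$G$ is $L$-Lipschitz" means $\|G(z)-G(w)\|_\star\le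 L\|z-w\|$ for all $z,w\in\mathcal{Z}$. OMWU: from $z_0=(x_0,y_0)$ and $z'_0=(x'_0,y'_0)$ in $\operatorname{ri}\mathcal{Z}$, for $t\ge 0$ set $g_{\mathcal{X},t}=\nabla_x f(z'_t)$, $g_{\mathcal{Y},t}=-\nabla_y f(z'_t)$, and $$x_{t+1,i}=\frac{x_{t,i}e^{-\eta g_{\mathcal{X},t,i}}}{\sum_{\ell=1}^n x_{t,\ell}e^{-\eta g_{\mathcal{X},t,\ell}}},\qquad y_{t+1,j}=\frac{y_{t,j}e^{-\eta g_{\mathcal{Y},t,j}}}{\sum_{\ell=1}^m y_{t,\ell}e^{-\eta g_{\mathcal{Y},t,\ell}}},$$ $$x'_{t+1,i}=\frac{x_{t+1,i}e^{-\eta g_{\mathcal{X},t,i}}}{\sum_{\ell=1}^n x_{t+1,\ell}e^{-\eta g_{\mathcal{X},t,\ell}}},\qquad y'_{t+1,j}=\frac{y_{t+1,j}e^{-\eta g_{\mathcal{Y},t,j}}}{\sum_{\ell=1}^m y_{t+1,\ell}e^{-\eta g_{\mathcal{Y},t,\ell}}},$$ with $z_{t}=(x_{t},y_{t})$ and $z'_{t}=(x'_{t},y'_{t})$. *)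

theory Defs
  imports "HOL-Analysis.Analysis"
begin

definition prob_simplex :: "(real^'d) set" where
  "prob_simplex = {p. (\<forall>i. 0 \<le> p $ i) \<and> (\<Sum>i\<in>UNIV. p $ i) = 1}"

abbreviation strategies :: "((real^'n) \<times> (real^'m)) set" where
  "strategies \<equiv> prob_simplex \<times> prob_simplex"

definition saddle_points :: "((real^'n) \<times> (real^'m) \<Rightarrow> real) \<Rightarrow> ((real^'n) \<times> (real^'m)) set" where
  "saddle_points f = {(x, y). (x, y) \<in> strategies \<and>
     (\<forall>(x', y') \<in> strategies. f (x, y') \<le> f (x, y) \<and> f (x, y) \<le> f (x', y))}"

definition convex_concave :: "((real^'n) \<times> (real^'m) \<Rightarrow> real) \<Rightarrow> bool" where
  "convex_concave f \<longleftrightarrow>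
     (\<forall>y \<in> prob_simplex. convex_on prob_simplex (\<lambda>x. f (x, y))) \<and>
     (\<forall>x \<in> prob_simplex. concave_on prob_simplex (\<lambda>y. f (x, y)))"

text \<open>
  A payoff function matters only on the product of simplices, which has empty interior, so its
  derivative is taken within that set. There a gradient is determined only up to adding a
  multiple of the all-ones vector to each block, hence a relation rather than a function. The
  gradient of any differentiable extension to a neighbourhood is one such \<open>g\<close>, with
  \<open>fst (g z)\<close> and \<open>snd (g z)\<close> the partial gradients in the two arguments.
\<close>
definition gradient_on_strategies ::
    "((real^'n) \<times> (real^'m) \<Rightarrow> real) \<Rightarrow> ((real^'n) \<times> (real^'m) \<Rightarrow> (real^'n) \<times> (real^'m)) \<Rightarrow> bool" where
  "gradient_on_strategies f g \<longleftrightarrow>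
     (\<forall>z \<in> strategies. (f has_derivative (\<lambda>h. g z \<bullet> h)) (at z within strategies))"

definition saddle_operator ::
    "((real^'n) \<times> (real^'m) \<Rightarrow> (real^'n) \<times> (real^'m)) \<Rightarrow> (real^'n) \<times> (real^'m) \<Rightarrow> (real^'n) \<times> (real^'m)" where
  "saddle_operator g z = (fst (g z), - snd (g z))"

definition l1_norm :: "real^'d \<Rightarrow> real" where
  "l1_norm x = (\<Sum>i\<in>UNIV. \<bar>x $ i\<bar>)"

definition znorm :: "(real^'n) \<times> (real^'m) \<Rightarrow> real" where
  "znorm z = sqrt ((l1_norm (fst z))\<^sup>2 + (l1_norm (snd z))\<^sup>2)"

definition znorm_dual :: "(real^'n) \<times> (real^'m) \<Rightarrow> real" where
  "znorm_dual w = sqrt ((infnorm (fst w))\<^sup>2 + (infnorm (snd w))\<^sup>2)"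

definition lipschitz_on_strategies ::
    "real \<Rightarrow> ((real^'n) \<times> (real^'m) \<Rightarrow> (real^'n) \<times> (real^'m)) \<Rightarrow> bool" where
  "lipschitz_on_strategies L G \<longleftrightarrow>
     (\<forall>z \<in> strategies. \<forall>w \<in> strategies. znorm_dual (G z - G w) \<le> L * znorm (z - w))"

definition mw_update :: "real \<Rightarrow> real^'d \<Rightarrow> real^'d \<Rightarrow> real^'d" where
  "mw_update \<eta> x g =
     (\<chi> i. x $ i * exp (- \<eta> * g $ i) / (\<Sum>l\<in>UNIV. x $ l * exp (- \<eta> * g $ l)))"

definition omwu_step ::
    "real \<Rightarrow> (real^'n) \<times> (real^'m) \<Rightarrow> (real^'n) \<times> (real^'m) \<Rightarrow> (real^'n) \<times> (real^'m)" where
  "omwu_step \<eta> z g = (mw_update \<eta> (fst z) (fst g), mw_update \<eta> (snd z) (snd g))"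

definition omwu ::
    "((real^'n) \<times> (real^'m) \<Rightarrow> (real^'n) \<times> (real^'m)) \<Rightarrow> real \<Rightarrow>
     (nat \<Rightarrow> (real^'n) \<times> (real^'m)) \<Rightarrow> (nat \<Rightarrow> (real^'n) \<times> (real^'m)) \<Rightarrow> bool" where
  "omwu G \<eta> z z' \<longleftrightarrow>
     (\<forall>t. z (Suc t) = omwu_step \<eta> (z t) (G (z' t)) \<and>
          z' (Suc t) = omwu_step \<eta> (z (Suc t)) (G (z' t)))"

end

theory Submission
  imports Defs
begin

text \<open>
  Saddle points are the solutions of the variational inequality \<open>G w \<bullet> (v - w) \<ge> 0\<close> for all
  strategies \<open>v\<close>, where \<open>G\<close> is the saddle operator, and convexity-concavity makes \<open>G\<close>
  monotone (\<open>saddle_operator_ge_gap\<close> and its consequences). What remains is a statement about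
  optimistic multiplicative weights for a monotone Lipschitz operator.

  For every strategy \<open>u\<close> the potential, the relative entropy from \<open>u\<close> to the iterate plus a
  multiple of the last squared displacement, satisfies
  \<open>potential u (t + 1) + \<alpha> * (squared displacements) \<le> potential u t - \<eta> * (G z' \<bullet> (z' - u))\<close>
  with \<open>\<alpha> > 0\<close> (\<open>potential_descent\<close>); Pinsker's inequality with its sharp constant is what
  turns \<open>3 * \<eta> * L < 1\<close> into \<open>\<alpha> > 0\<close>. For a saddle point \<open>u\<close> the inner product is nonnegative,
  so the displacements tend to zero and every limit point \<open>w\<close> is a fixed point of the update:
  each coordinate in the support of \<open>w\<close> has growth factor exactly 1 there.

  Fixed points on the boundary need not be saddle points: a coordinate that vanishes at \<open>w\<close> may
  have a growth factor above 1. The heart of the proof, \<open>limit_growth_le_1\<close>, excludes this for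
  limit points. Near \<open>w\<close> such coordinates grow geometrically, but the displacements vanish, so
  these coordinates must be tiny there. By monotonicity they are also the only terms through
  which \<open>potential w\<close> can increase, and because of the geometric growth their accumulated
  contribution is at most a constant times their current size. Hence an iterate that comes close
  enough to \<open>w\<close> late enough never leaves a neighbourhood of \<open>w\<close>, in which the growing
  coordinates are bounded below and yet must tend to zero, a contradiction. So all growth factors
  at \<open>w\<close> are at most 1, which is the variational inequality. Then \<open>potential w\<close> itself is
  decreasing, and it tends to zero along a subsequence, hence altogether.
\<close>

section \<open>Coordinates and norms\<close>

text \<open>
  Indexing both players' coordinates by one sum type lets the entropy and the growth factors be
  treated without distinguishing the two blocks.
\<close>
definition coord :: "(real^'n) \<times> (real^'m) \<Rightarrow> 'n + 'm \<Rightarrow> real" where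
  "coord z k = (case k of Inl i \<Rightarrow> fst z $ i | Inr j \<Rightarrow> snd z $ j)"

lemma coord_simps [simp]:
  "coord z (Inl i) = fst z $ i" "coord z (Inr j) = snd z $ j"
  "coord (v - w) k = coord v k - coord w k"
  by (auto simp: coord_def split: sum.split)

lemma sum_coord_split:
  fixes F :: "'n::finite + 'm::finite \<Rightarrow> real"
  shows "(\<Sum>k\<in>UNIV. F k) = (\<Sum>i\<in>UNIV. F (Inl i)) + (\<Sum>j\<in>UNIV. F (Inr j))"
  by (simp add: UNIV_Plus_UNIV [symmetric] sum.Plus del: UNIV_Plus_UNIV)

lemma inner_coord:
  fixes v w :: "(real^'n) \<times> (real^'m)"
  shows "v \<bullet> w = (\<Sum>k\<in>UNIV. coord v k * coord w k)"
  by (simp add: sum_coord_split inner_prod_def inner_vec_def)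

lemma strategies_coord_nonneg: "z \<in> strategies \<Longrightarrow> 0 \<le> coord z k"
  by (cases k) (auto simp: prob_simplex_def)

lemma tendsto_coord [tendsto_intros]:
  "(h \<longlongrightarrow> l) F \<Longrightarrow> ((\<lambda>x. coord (h x) k) \<longlongrightarrow> coord l k) F"
  by (cases k) (auto intro!: tendsto_intros)

lemma compact_prob_simplex: "compact (prob_simplex :: (real^'d) set)"
proof -
  have "closed (prob_simplex :: (real^'d) set)"
    unfolding prob_simplex_def
    by (intro closed_Collect_conj closed_Collect_all closed_Collect_le closed_Collect_eq
        continuous_intros)
  moreover have "norm x \<le> 1" if "x \<in> prob_simplex" for x :: "real^'d"
    using that norm_le_l1_cart [of x] by (simp add: prob_simplex_def)
  then have "bounded (prob_simplex :: (real^'d) set)"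
    by (auto simp: bounded_iff)
  ultimately show ?thesis by (simp add: compact_eq_bounded_closed)
qed

lemma convex_prob_simplex: "convex (prob_simplex :: (real^'d) set)"
  unfolding convex_def prob_simplex_def
  by (auto simp: sum.distrib sum_distrib_left [symmetric])

text \<open>
  A segment from the vertex \<open>axis i 1\<close> to a relative interior point \<open>x\<close> can be prolonged a little
  beyond \<open>x\<close> inside the simplex; if \<open>x $ i\<close> were zero, this would make coordinate \<open>i\<close> negative.
\<close>
lemma rel_interior_prob_simplex_pos:
  fixes x :: "real^'d"
  assumes x: "x \<in> rel_interior prob_simplex"
  shows "0 < x $ i"
proof -
  have "axis i 1 \<in> (prob_simplex :: (real^'d) set)"
    by (auto simp: prob_simplex_def axis_def)
  then obtain e where "e > 1" "(1 - e) *\<^sub>R axis i 1 + e *\<^sub>R x \<in> prob_simplex"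
    using x convex_rel_interior_iff [OF convex_prob_simplex] by blast
  then have "0 \<le> (1 - e) + e * x $ i"
    by (auto simp: prob_simplex_def axis_def dest!: spec [of _ i])
  with \<open>e > 1\<close> have "0 < e * x $ i" by linarith
  with \<open>e > 1\<close> show ?thesis by (simp add: zero_less_mult_iff)
qed

lemma rel_interior_strategies_pos:
  fixes z :: "(real^'n) \<times> (real^'m)"
  assumes "z \<in> rel_interior strategies"
  shows "z \<in> strategies" "0 < coord z k"
proof -
  show "z \<in> strategies" using assms rel_interior_subset by blast
  have "z \<in> rel_interior prob_simplex \<times> rel_interior prob_simplex"
    using assms rel_interior_Times [OF convex_prob_simplex convex_prob_simplex] by blast
  then show "0 < coord z k" by (cases k) (auto simp: rel_interior_prob_simplex_pos)
qed

lemma znorm_eq_norm: "znorm z = norm (l1_norm (fst z), l1_norm (snd z))"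
  by (simp add: znorm_def norm_Pair)

lemma l1_norm_nonneg: "0 \<le> l1_norm x"
  by (simp add: l1_norm_def sum_nonneg)

lemma l1_norm_triangle: "l1_norm (x + y) \<le> l1_norm x + l1_norm y"
  by (simp add: l1_norm_def sum.distrib [symmetric] sum_mono)

lemma znorm_nonneg: "0 \<le> znorm z"
  by (simp add: znorm_eq_norm)

lemma znorm_minus_commute: "znorm (v - w) = znorm (w - v)"
  by (simp add: znorm_def l1_norm_def abs_minus_commute)

lemma znorm_triangle: "znorm (v + w) \<le> znorm v + znorm w"
proof -
  have "znorm (v + w) \<le> norm ((l1_norm (fst v), l1_norm (snd v)) + (l1_norm (fst w), l1_norm (snd w)))"
    unfolding znorm_eq_norm norm_Pair add_Pair fst_add snd_add
    by (intro real_sqrt_le_mono add_mono power_mono)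
       (auto simp: l1_norm_triangle l1_norm_nonneg)
  also have "\<dots> \<le> znorm v + znorm w"
    unfolding znorm_eq_norm by (rule norm_triangle_ineq)
  finally show ?thesis .
qed

lemma norm_le_znorm: "norm z \<le> znorm z"
  by (cases z) (auto simp: znorm_def norm_Pair l1_norm_def intro!: real_sqrt_le_mono add_mono
      power_mono norm_le_l1_cart)

lemma coord_le_znorm: "\<bar>coord z k\<bar> \<le> znorm z"
proof -
  have "\<bar>coord z k\<bar> \<le> norm z"
  proof (cases k)
    case (Inl i)
    then show ?thesis
      using component_le_norm_cart [of "fst z" i] norm_fst_le [of "fst z" "snd z"] by simp
  next
    case (Inr j)
    then show ?thesis
      using component_le_norm_cart [of "snd z" j] norm_snd_le [of "snd z" "fst z"] by simp
  qed
  with norm_le_znorm [of z] show ?thesis by simp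
qed

lemma coord_le_znorm_dual:
  fixes w :: "(real^'n) \<times> (real^'m)"
  shows "\<bar>coord w k\<bar> \<le> znorm_dual w"
proof (cases k)
  case (Inl i)
  then have "\<bar>coord w k\<bar> \<le> infnorm (fst w)" by (simp add: component_le_infnorm_cart)
  also have "\<dots> \<le> znorm_dual w" unfolding znorm_dual_def by (rule real_le_rsqrt) simp
  finally show ?thesis .
next
  case (Inr j)
  then have "\<bar>coord w k\<bar> \<le> infnorm (snd w)" by (simp add: component_le_infnorm_cart)
  also have "\<dots> \<le> znorm_dual w" unfolding znorm_dual_def by (rule real_le_rsqrt) simp
  finally show ?thesis .
qed

lemma inner_le_infnorm_l1_norm: "a \<bullet> b \<le> infnorm a * l1_norm b" for a b :: "real^'d"
proof -
  have "a $ i * b $ i \<le> infnorm a * \<bar>b $ i\<bar>" for i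
  proof -
    have "a $ i * b $ i \<le> \<bar>a $ i\<bar> * \<bar>b $ i\<bar>"
      by (metis abs_ge_self abs_mult)
    also have "\<dots> \<le> infnorm a * \<bar>b $ i\<bar>"
      by (intro mult_right_mono component_le_infnorm_cart) simp
    finally show ?thesis .
  qed
  then show ?thesis
    by (simp add: inner_vec_def l1_norm_def sum_distrib_left sum_mono)
qed

lemma inner_le_znorm_dual:
  fixes v w :: "(real^'n) \<times> (real^'m)"
  shows "w \<bullet> v \<le> znorm_dual w * znorm v"
proof -
  have "w \<bullet> v \<le> (infnorm (fst w), infnorm (snd w)) \<bullet> (l1_norm (fst v), l1_norm (snd v))"
    using inner_le_infnorm_l1_norm [of "fst w" "fst v"]
      inner_le_infnorm_l1_norm [of "snd w" "snd v"] by (simp add: inner_prod_def)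
  also have "\<dots> \<le> norm (infnorm (fst w), infnorm (snd w)) * norm (l1_norm (fst v), l1_norm (snd v))"
    by (rule norm_cauchy_schwarz)
  also have "\<dots> = znorm_dual w * znorm v"
    by (simp add: znorm_eq_norm znorm_dual_def norm_Pair)
  finally show ?thesis .
qed

lemma tendsto_znorm_0:
  assumes "(h \<longlongrightarrow> l) F"
  shows "((\<lambda>x. znorm (h x - l)) \<longlongrightarrow> 0) F"
proof -
  have "((\<lambda>x. znorm (h x - l)) \<longlongrightarrow> znorm (l - l)) F"
    unfolding znorm_def l1_norm_def using assms by (intro tendsto_intros)
  then show ?thesis by (simp add: znorm_def l1_norm_def)
qed

lemma tendsto_0_if_square_tendsto_0:
  fixes h :: "'a \<Rightarrow> real"
  assumes "((\<lambda>x. (h x)\<^sup>2) \<longlongrightarrow> 0) F"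
  shows "(h \<longlongrightarrow> 0) F"
proof -
  have "((\<lambda>x. \<bar>h x\<bar>) \<longlongrightarrow> 0) F" using tendsto_real_sqrt [OF assms] by simp
  then show ?thesis by (rule tendsto_rabs_zero_cancel)
qed

section \<open>Pinsker's inequality\<close>

text \<open>
  The two sides and their first derivatives agree at 1, and the second derivative of the
  difference is nonnegative because \<open>27 * a \<le> (a + 2) ^ 3\<close> (AM-GM). Unlike a bound by a multiple
  of \<open>(a - 1)\<^sup>2\<close>, the quotient keeps the inequality valid for large \<open>a\<close>.
\<close>
lemma pinsker_scalar:
  fixes a :: real
  assumes "0 < a"
  shows "3 * (a - 1)\<^sup>2 / (2 * (a + 2)) \<le> a * ln a - a + 1"
proof -
  \<comment> \<open>partial fractions: \<open>(a - 1)\<^sup>2 / (a + 2) = a - 4 + 9 / (a + 2)\<close>\<close>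
  define \<psi> where "\<psi> a = a * ln a - a + 1 - (3 / 2 * (a - 4) + 27 / 2 * inverse (a + 2))" for a :: real
  define \<psi>' where "\<psi>' a = ln a - 3 / 2 + 27 / 2 * inverse ((a + 2)\<^sup>2)" for a :: real
  define \<psi>'' where "\<psi>'' a = inverse a - 27 * inverse ((a + 2) ^ 3)" for a :: real
  have d1: "(\<psi> has_real_derivative \<psi>' a) (at a)" if "0 < a" for a
    unfolding \<psi>_def \<psi>'_def using that
    by (auto intro!: derivative_eq_intros simp: power2_eq_square)
  have d2: "(\<psi>' has_real_derivative \<psi>'' a) (at a)" if "0 < a" for a
    unfolding \<psi>'_def \<psi>''_def using that
    by (auto intro!: derivative_eq_intros) (simp add: divide_simps power2_eq_square power3_eq_cube, algebra)
  have pos: "0 \<le> \<psi>'' a" if "0 < a" for a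
  proof -
    have "(a + 2) ^ 3 - 27 * a = (a - 1)\<^sup>2 * (a + 8)" by algebra
    moreover have "0 \<le> (a - 1)\<^sup>2 * (a + 8)" using that by simp
    ultimately have "27 * a \<le> (a + 2) ^ 3" by linarith
    then show ?thesis unfolding \<psi>''_def using that by (simp add: field_simps)
  qed
  have "convex_on {0<..} \<psi>"
    by (rule f''_ge0_imp_convex [where f' = \<psi>' and f'' = \<psi>'']) (auto simp: d1 d2 pos)
  then have "\<psi> a - \<psi> 1 \<ge> \<psi>' 1 * (a - 1)"
    by (rule convex_on_imp_above_tangent [where A = "{0<..}"])
       (use assms d1 [of 1] in \<open>auto simp: interior_open has_field_derivative_at_within\<close>)
  then have "3 / 2 * (a - 4) + 27 / 2 * inverse (a + 2) \<le> a * ln a - a + 1"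
    by (simp add: \<psi>_def \<psi>'_def)
  also have "3 / 2 * (a - 4) + 27 / 2 * inverse (a + 2) = 3 * (a - 1)\<^sup>2 / (2 * (a + 2))"
    using assms by (simp add: divide_simps) algebra
  finally show ?thesis .
qed

text \<open>
  Applying the scalar inequality to \<open>a = p $ i / q $ i\<close> bounds the entropy below by
  \<open>3/2\<close> times the sum of \<open>(p - q)\<^sup>2 / (p + 2 * q)\<close>. The weights \<open>p + 2 * q\<close> have total mass 3, so
  Cauchy-Schwarz gives the squared \<open>l\<^sub>1\<close> distance with constant \<open>3/2 \<cdot> 1/3 = 1/2\<close>.
\<close>
lemma pinsker_simplex:
  fixes p q :: "real^'d"
  assumes p: "p \<in> prob_simplex" and q: "q \<in> prob_simplex" and q_pos: "\<And>i. 0 < q $ i"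
  shows "(l1_norm (p - q))\<^sup>2 \<le> 2 * (\<Sum>i\<in>UNIV. p $ i * (ln (p $ i) - ln (q $ i)))"
proof -
  define s where "s i = p $ i + 2 * q $ i" for i
  have p_nonneg: "0 \<le> p $ i" for i using p by (simp add: prob_simplex_def)
  have s_pos: "0 < s i" for i using p_nonneg [of i] q_pos [of i] by (simp add: s_def)
  have sums: "(\<Sum>i\<in>UNIV. p $ i) = 1" "(\<Sum>i\<in>UNIV. q $ i) = 1"
    using p q by (auto simp: prob_simplex_def)
  have summand: "3 / 2 * ((p $ i - q $ i)\<^sup>2 / s i) \<le> p $ i * (ln (p $ i) - ln (q $ i)) - p $ i + q $ i" for i
  proof (cases "p $ i = 0")
    case True
    then show ?thesis using q_pos [of i] by (simp add: s_def power2_eq_square)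
  next
    case False
    define a where "a = p $ i / q $ i"
    have a: "0 < a" using False p_nonneg [of i] q_pos [of i] by (simp add: a_def)
    have p_eq: "p $ i = a * q $ i" using q_pos [of i] by (simp add: a_def)
    have "q $ i * (3 * (a - 1)\<^sup>2 / (2 * (a + 2))) \<le> q $ i * (a * ln a - a + 1)"
      using pinsker_scalar [OF a] q_pos [of i] by (intro mult_left_mono) auto
    also have "q $ i * (3 * (a - 1)\<^sup>2 / (2 * (a + 2))) = 3 / 2 * ((p $ i - q $ i)\<^sup>2 / s i)"
    proof -
      have "(p $ i - q $ i)\<^sup>2 = (q $ i * q $ i) * (a - 1)\<^sup>2" "s i = q $ i * (a + 2)"
        unfolding s_def p_eq by algebra+
      then show ?thesis using q_pos [of i] a by simp
    qed
    also have "ln a = ln (p $ i) - ln (q $ i)"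
      using False p_nonneg [of i] q_pos [of i] by (simp add: a_def ln_div)
    finally show ?thesis by (simp add: p_eq algebra_simps)
  qed
  have "(l1_norm (p - q))\<^sup>2 = (\<Sum>i\<in>UNIV. (\<bar>p $ i - q $ i\<bar> / sqrt (s i)) * sqrt (s i))\<^sup>2"
    using s_pos by (simp add: l1_norm_def less_imp_neq [symmetric])
  also have "\<dots> \<le> (\<Sum>i\<in>UNIV. (\<bar>p $ i - q $ i\<bar> / sqrt (s i))\<^sup>2) * (\<Sum>i\<in>UNIV. (sqrt (s i))\<^sup>2)"
    by (rule Cauchy_Schwarz_ineq_sum)
  also have "(\<Sum>i\<in>UNIV. (sqrt (s i))\<^sup>2) = 3"
    using s_pos sums by (simp add: less_imp_le s_def sum.distrib sum_distrib_left [symmetric])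
  also have "(\<Sum>i\<in>UNIV. (\<bar>p $ i - q $ i\<bar> / sqrt (s i))\<^sup>2) * 3
      = 2 * (\<Sum>i\<in>UNIV. 3 / 2 * ((p $ i - q $ i)\<^sup>2 / s i))"
    using s_pos by (simp add: power_divide less_imp_le sum_distrib_left sum_distrib_right algebra_simps)
  also have "\<dots> \<le> 2 * (\<Sum>i\<in>UNIV. p $ i * (ln (p $ i) - ln (q $ i)) - p $ i + q $ i)"
    using summand by (intro mult_left_mono sum_mono) auto
  also have "\<dots> = 2 * (\<Sum>i\<in>UNIV. p $ i * (ln (p $ i) - ln (q $ i)))"
    by (simp add: sum.distrib sum_subtractf sums)
  finally show ?thesis .
qed

text \<open>
  The Kullback-Leibler divergence, added over the two blocks. The convention \<open>0 * ln 0 = 0\<close> comes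
  out right whatever value \<open>ln 0\<close> has.
\<close>
definition kl :: "(real^'n) \<times> (real^'m) \<Rightarrow> (real^'n) \<times> (real^'m) \<Rightarrow> real" where
  "kl u z = (\<Sum>k\<in>UNIV. coord u k * (ln (coord u k) - ln (coord z k)))"

lemma pinsker:
  fixes u z :: "(real^'n) \<times> (real^'m)"
  assumes "u \<in> strategies" "z \<in> strategies" "\<And>k. 0 < coord z k"
  shows "(znorm (u - z))\<^sup>2 / 2 \<le> kl u z"
proof -
  have "(l1_norm (fst u - fst z))\<^sup>2 \<le> 2 * (\<Sum>i\<in>UNIV. fst u $ i * (ln (fst u $ i) - ln (fst z $ i)))"
    using assms assms(3) [of "Inl _"] by (intro pinsker_simplex) auto
  moreover have "(l1_norm (snd u - snd z))\<^sup>2 \<le> 2 * (\<Sum>i\<in>UNIV. snd u $ i * (ln (snd u $ i) - ln (snd z $ i)))"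
    using assms assms(3) [of "Inr _"] by (intro pinsker_simplex) auto
  ultimately show ?thesis by (simp add: znorm_def kl_def sum_coord_split)
qed

text \<open>
  The divergence is discontinuous in its second argument at the boundary, but not along a
  sequence whose limit is the first argument: coordinates outside the support of \<open>w\<close> have weight
  zero, and on the support the logarithm is continuous.
\<close>
lemma tendsto_kl_0:
  fixes w :: "(real^'n) \<times> (real^'m)"
  assumes "(h \<longlongrightarrow> w) F" and "w \<in> strategies"
  shows "((\<lambda>x. kl w (h x)) \<longlongrightarrow> 0) F"
proof -
  have summand: "((\<lambda>x. coord w k * (ln (coord w k) - ln (coord (h x) k))) \<longlongrightarrow> 0) F" for k
  proof (cases "coord w k = 0")
    case False
    then have "((\<lambda>x. coord w k * (ln (coord w k) - ln (coord (h x) k)))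
        \<longlongrightarrow> coord w k * (ln (coord w k) - ln (coord w k))) F"
      by (intro tendsto_intros assms)
    then show ?thesis by simp
  qed simp
  have "((\<lambda>x. kl w (h x)) \<longlongrightarrow> (\<Sum>k\<in>(UNIV :: ('n + 'm) set). 0)) F"
    unfolding kl_def by (intro tendsto_sum summand)
  then show ?thesis by simp
qed

section \<open>The multiplicative-weights step\<close>

text \<open>
  The factor by which one step from \<open>z\<close> against the gradient \<open>g\<close> multiplies coordinate \<open>k\<close>.
\<close>
definition growth ::
    "real \<Rightarrow> (real^'n) \<times> (real^'m) \<Rightarrow> (real^'n) \<times> (real^'m) \<Rightarrow> 'n + 'm \<Rightarrow> real" where
  "growth \<eta> z g k = exp (- \<eta> * coord g k) /
     (case k of Inl _ \<Rightarrow> \<Sum>l\<in>UNIV. fst z $ l * exp (- \<eta> * fst g $ l)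
              | Inr _ \<Rightarrow> \<Sum>l\<in>UNIV. snd z $ l * exp (- \<eta> * snd g $ l))"

lemma normaliser_pos:
  fixes x :: "real^'d"
  assumes "x \<in> prob_simplex"
  shows "0 < (\<Sum>l\<in>UNIV. x $ l * exp (c l))"
proof (rule ccontr)
  have nonneg: "0 \<le> x $ l * exp (c l)" for l using assms by (simp add: prob_simplex_def)
  assume "\<not> ?thesis"
  then have "(\<Sum>l\<in>UNIV. x $ l * exp (c l)) = 0"
    using nonneg by (meson antisym not_less sum_nonneg)
  then have "\<forall>l\<in>UNIV. x $ l * exp (c l) = 0"
    using nonneg by (subst (asm) sum_nonneg_eq_0_iff) auto
  then have "(\<Sum>l\<in>UNIV. x $ l) = 0" by simp
  with assms show False by (simp add: prob_simplex_def)
qed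

lemma growth_pos: "z \<in> strategies \<Longrightarrow> 0 < growth \<eta> z g k"
  unfolding growth_def
  by (cases k) (auto simp: mem_Times_iff intro!: divide_pos_pos normaliser_pos)

lemma coord_omwu_step: "coord (omwu_step \<eta> z g) k = coord z k * growth \<eta> z g k"
  by (cases k) (auto simp: omwu_step_def mw_update_def growth_def)

lemma omwu_step_pos:
  "z \<in> strategies \<Longrightarrow> 0 < coord z k \<Longrightarrow> 0 < coord (omwu_step \<eta> z g) k"
  by (simp add: coord_omwu_step growth_pos)

lemma mw_update_prob_simplex:
  assumes "x \<in> prob_simplex" shows "mw_update \<eta> x g \<in> prob_simplex"
  using assms normaliser_pos [OF assms, of "\<lambda>l. - \<eta> * g $ l"]
  by (auto simp: prob_simplex_def mw_update_def sum_divide_distrib [symmetric])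

lemma omwu_step_strategies: "z \<in> strategies \<Longrightarrow> omwu_step \<eta> z g \<in> strategies"
  by (auto simp: omwu_step_def mw_update_prob_simplex)

text \<open>
  The logarithm of a growth factor is \<open>- \<eta> * coord g k\<close> up to a constant in each block, and the
  constants cancel because \<open>u\<close> and \<open>v\<close> have the same mass in each block. This identity gives the
  three-point identity below; later it also turns bounds on growth factors into the variational
  inequality.
\<close>
lemma sum_ln_growth:
  fixes z g u v :: "(real^'n) \<times> (real^'m)"
  assumes "z \<in> strategies" "u \<in> strategies" "v \<in> strategies"
  shows "(\<Sum>k\<in>UNIV. (coord u k - coord v k) * ln (growth \<eta> z g k)) = \<eta> * (g \<bullet> (v - u))"
proof -
  define A where "A = (\<Sum>l\<in>UNIV. fst z $ l * exp (- \<eta> * fst g $ l))"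
  define B where "B = (\<Sum>l\<in>UNIV. snd z $ l * exp (- \<eta> * snd g $ l))"
  have A: "0 < A" and B: "0 < B"
    unfolding A_def B_def using assms(1) by (auto simp: mem_Times_iff intro!: normaliser_pos)
  have sums: "(\<Sum>i\<in>UNIV. fst u $ i) = 1" "(\<Sum>i\<in>UNIV. fst v $ i) = 1"
      "(\<Sum>i\<in>UNIV. snd u $ i) = 1" "(\<Sum>i\<in>UNIV. snd v $ i) = 1"
    using assms by (auto simp: prob_simplex_def)
  have l: "ln (growth \<eta> z g (Inl i)) = - \<eta> * fst g $ i - ln A" for i
    using A unfolding growth_def coord_simps sum.case A_def [symmetric] by (simp add: ln_div)
  have r: "ln (growth \<eta> z g (Inr j)) = - \<eta> * snd g $ j - ln B" for j
    using B unfolding growth_def coord_simps sum.case B_def [symmetric] by (simp add: ln_div)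
  have "(\<Sum>i\<in>UNIV. (fst u $ i - fst v $ i) * (- \<eta> * fst g $ i - ln A))
      = \<eta> * (\<Sum>i\<in>UNIV. fst g $ i * (fst v $ i - fst u $ i))
        - ln A * ((\<Sum>i\<in>UNIV. fst u $ i) - (\<Sum>i\<in>UNIV. fst v $ i))"
    unfolding sum_distrib_left sum_subtractf [symmetric] by (rule sum.cong) (auto simp: algebra_simps)
  moreover have "(\<Sum>i\<in>UNIV. (snd u $ i - snd v $ i) * (- \<eta> * snd g $ i - ln B))
      = \<eta> * (\<Sum>i\<in>UNIV. snd g $ i * (snd v $ i - snd u $ i))
        - ln B * ((\<Sum>i\<in>UNIV. snd u $ i) - (\<Sum>i\<in>UNIV. snd v $ i))"
    unfolding sum_distrib_left sum_subtractf [symmetric] by (rule sum.cong) (auto simp: algebra_simps)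
  ultimately show ?thesis
    by (simp add: sum_coord_split l r sums inner_coord distrib_left)
qed

lemma kl_three_point:
  fixes z u g :: "(real^'n) \<times> (real^'m)" and \<eta> :: real
  assumes "z \<in> strategies" "\<And>k. 0 < coord z k" "u \<in> strategies"
  defines "w \<equiv> omwu_step \<eta> z g"
  shows "\<eta> * (g \<bullet> (w - u)) = kl u z - kl u w - kl w z"
proof -
  have ln_w: "ln (coord w k) - ln (coord z k) = ln (growth \<eta> z g k)" for k
    using assms(2) [of k] growth_pos [OF assms(1), of \<eta> g k]
    by (simp add: w_def coord_omwu_step ln_mult)
  have "kl u z - kl u w = (\<Sum>k\<in>UNIV. coord u k * (ln (coord w k) - ln (coord z k)))"
    unfolding kl_def sum_subtractf [symmetric] by (rule sum.cong) (auto simp: algebra_simps)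
  moreover have "kl w z = (\<Sum>k\<in>UNIV. coord w k * (ln (coord w k) - ln (coord z k)))"
    by (simp add: kl_def)
  ultimately have "kl u z - kl u w - kl w z
      = (\<Sum>k\<in>UNIV. (coord u k - coord w k) * ln (growth \<eta> z g k))"
    by (simp add: ln_w sum_subtractf [symmetric] left_diff_distrib)
  also have "\<dots> = \<eta> * (g \<bullet> (w - u))"
    using assms by (intro sum_ln_growth) (auto simp: w_def omwu_step_strategies)
  finally show ?thesis by simp
qed

section \<open>The saddle operator of a convex-concave function\<close>

text \<open>
  The first-order inequality of a convex function in a form that only needs convexity along one
  segment and a derivative within a set that may have empty interior.
\<close>
lemma derivative_le_difference:
  fixes h :: "'a::real_normed_vector \<Rightarrow> real"
  assumes deriv: "(h has_derivative D) (at z within S)"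
    and seg: "\<And>t. 0 \<le> t \<Longrightarrow> t \<le> 1 \<Longrightarrow> z + t *\<^sub>R (w - z) \<in> S"
    and below: "\<And>t. 0 \<le> t \<Longrightarrow> t \<le> 1 \<Longrightarrow> h (z + t *\<^sub>R (w - z)) \<le> (1 - t) * h z + t * h w"
  shows "D (w - z) \<le> h w - h z"
proof -
  define \<phi> where "\<phi> t = h (z + t *\<^sub>R (w - z))" for t :: real
  interpret D: bounded_linear D using deriv by (rule has_derivative_bounded_linear)
  have "((\<lambda>t. z + t *\<^sub>R (w - z)) has_derivative (\<lambda>t. t *\<^sub>R (w - z))) (at 0 within {0..1})"
    by (auto intro!: derivative_eq_intros)
  moreover have "(h has_derivative D) (at (z + 0 *\<^sub>R (w - z)) within (\<lambda>t. z + t *\<^sub>R (w - z)) ` {0..1})"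
    using deriv seg by (auto intro: has_derivative_subset)
  ultimately have "(\<phi> has_derivative (\<lambda>t. D (t *\<^sub>R (w - z)))) (at 0 within {0..1})"
    unfolding \<phi>_def by (rule has_derivative_in_compose)
  moreover have "(\<lambda>t. D (t *\<^sub>R (w - z))) = (*) (D (w - z))"
    by (auto simp: D.scaleR)
  ultimately have "(\<phi> has_real_derivative D (w - z)) (at 0 within {0..1})"
    by (simp add: has_field_derivative_def)
  then have lim: "((\<lambda>t. (\<phi> t - \<phi> 0) / (t - 0)) \<longlongrightarrow> D (w - z)) (at 0 within {0..1})"
    by (simp add: has_field_derivative_iff)
  show ?thesis
  proof (rule tendsto_upperbound [OF lim])
    show "\<forall>\<^sub>F t in at 0 within {0..1}. (\<phi> t - \<phi> 0) / (t - 0) \<le> h w - h z"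
      unfolding eventually_at_filter
    proof (rule always_eventually, intro allI impI)
      fix t :: real assume "t \<noteq> 0" "t \<in> {0..1}"
      then show "(\<phi> t - \<phi> 0) / (t - 0) \<le> h w - h z"
        using below [of t] by (simp add: \<phi>_def field_simps)
    qed
    show "at 0 within {0..1::real} \<noteq> bot"
      by (simp add: at_within_Icc_at_right)
  qed
qed

text \<open>
  The sum of the first-order inequalities for moving the first argument (convexity) and the second
  one (concavity); the two occurrences of \<open>f z\<close> cancel. Everything used about \<open>f\<close> follows
  from this one inequality.
\<close>
lemma saddle_operator_ge_gap:
  fixes f :: "(real^'n) \<times> (real^'m) \<Rightarrow> real"
  assumes grad: "gradient_on_strategies f g" and cc: "convex_concave f"
    and z: "z \<in> strategies" and w: "w \<in> strategies"
  shows "f (fst z, snd w) - f (fst w, snd z) \<le> saddle_operator g z \<bullet> (z - w)"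
proof -
  obtain x y a b where zw: "z = (x, y)" "w = (a, b)" by (cases z, cases w)
  have mem: "x \<in> prob_simplex" "y \<in> prob_simplex" "a \<in> prob_simplex" "b \<in> prob_simplex"
    using z w zw by auto
  have deriv: "(f has_derivative (\<lambda>h. g z \<bullet> h)) (at (x, y) within strategies)"
    using grad z zw by (auto simp: gradient_on_strategies_def)
  have neg_deriv:
    "((\<lambda>v. - f v) has_derivative (\<lambda>h. - g z \<bullet> h)) (at (x, y) within strategies)"
    using has_derivative_minus [OF deriv] by simp
  have "g z \<bullet> ((a, y) - (x, y)) \<le> f (a, y) - f (x, y)"
  proof (rule derivative_le_difference [OF deriv])
    fix t :: real assume t: "0 \<le> t" "t \<le> 1"
    have eq: "(x, y) + t *\<^sub>R ((a, y) - (x, y)) = ((1 - t) *\<^sub>R x + t *\<^sub>R a, y)"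
      by (simp add: algebra_simps)
    show "(x, y) + t *\<^sub>R ((a, y) - (x, y)) \<in> strategies"
      unfolding eq using t mem convexD_alt [OF convex_prob_simplex] by auto
    have "convex_on prob_simplex (\<lambda>x. f (x, y))" using cc mem by (auto simp: convex_concave_def)
    then show "f ((x, y) + t *\<^sub>R ((a, y) - (x, y))) \<le> (1 - t) * f (x, y) + t * f (a, y)"
      unfolding eq using convex_onD t mem by blast
  qed
  moreover have "- g z \<bullet> ((x, b) - (x, y)) \<le> - f (x, b) - - f (x, y)"
  proof (rule derivative_le_difference [OF neg_deriv])
    fix t :: real assume t: "0 \<le> t" "t \<le> 1"
    have eq: "(x, y) + t *\<^sub>R ((x, b) - (x, y)) = (x, (1 - t) *\<^sub>R y + t *\<^sub>R b)"
      by (simp add: algebra_simps)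
    show "(x, y) + t *\<^sub>R ((x, b) - (x, y)) \<in> strategies"
      unfolding eq using t mem convexD_alt [OF convex_prob_simplex] by auto
    have "convex_on prob_simplex (\<lambda>y. - f (x, y))"
      using cc mem by (auto simp: convex_concave_def concave_on_def)
    then show "- f ((x, y) + t *\<^sub>R ((x, b) - (x, y))) \<le> (1 - t) * - f (x, y) + t * - f (x, b)"
      unfolding eq using convex_onD t mem by blast
  qed
  ultimately show ?thesis
    by (simp add: saddle_operator_def zw inner_prod_def inner_diff_right)
qed

lemma saddle_operator_monotone:
  fixes f :: "(real^'n) \<times> (real^'m) \<Rightarrow> real"
  assumes "gradient_on_strategies f g" "convex_concave f" "v \<in> strategies" "w \<in> strategies"
  shows "0 \<le> (saddle_operator g v - saddle_operator g w) \<bullet> (v - w)"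
  using saddle_operator_ge_gap [OF assms] saddle_operator_ge_gap [OF assms(1,2,4,3)]
  by (simp add: inner_diff_left inner_diff_right)

text \<open>
  The gap in \<open>saddle_operator_ge_gap\<close> is nonnegative when the second point is a saddle point.
  This yields the inequality with \<open>G\<close> evaluated at the varying point, which is what the descent
  argument uses; the converse below is for the inequality with \<open>G\<close> evaluated at the solution.
\<close>
lemma saddle_point_Minty:
  fixes f :: "(real^'n) \<times> (real^'m) \<Rightarrow> real"
  assumes "gradient_on_strategies f g" "convex_concave f" "u \<in> saddle_points f" "v \<in> strategies"
  shows "0 \<le> saddle_operator g v \<bullet> (v - u)"
proof -
  have u: "u \<in> strategies" "f (fst u, snd v) \<le> f u" "f u \<le> f (fst v, snd u)"
    using assms(3,4) by (cases u, cases v, auto simp: saddle_points_def)+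
  with saddle_operator_ge_gap [OF assms(1,2,4) u(1)] show ?thesis by linarith
qed

lemma saddle_point_if_Stampacchia:
  fixes f :: "(real^'n) \<times> (real^'m) \<Rightarrow> real"
  assumes "gradient_on_strategies f g" "convex_concave f" and w: "w \<in> strategies"
    and sol: "\<And>v. v \<in> strategies \<Longrightarrow> 0 \<le> saddle_operator g w \<bullet> (v - w)"
  shows "w \<in> saddle_points f"
proof -
  have ineq: "f (fst w, snd v) \<le> f (fst v, snd w)" if "v \<in> strategies" for v
    using saddle_operator_ge_gap [OF assms(1,2) w that] sol [OF that]
    by (simp add: inner_diff_right)
  have "f (fst w, y) \<le> f w \<and> f w \<le> f (x, snd w)" if "x \<in> prob_simplex" "y \<in> prob_simplex" for x y
    using ineq [of "(fst w, y)"] ineq [of "(x, snd w)"] w that by auto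
  then show ?thesis using w by (cases w) (auto simp: saddle_points_def)
qed

section \<open>Optimistic multiplicative weights for a monotone operator\<close>

locale monotone_omwu =
  fixes G :: "(real^'n) \<times> (real^'m) \<Rightarrow> (real^'n) \<times> (real^'m)"
    and \<eta> L :: real
    and z z' :: "nat \<Rightarrow> (real^'n) \<times> (real^'m)"
  assumes lipschitz: "lipschitz_on_strategies L G"
    and monotone: "\<And>v w. v \<in> strategies \<Longrightarrow> w \<in> strategies \<Longrightarrow> 0 \<le> (G v - G w) \<bullet> (v - w)"
    and eta_pos: "0 < \<eta>" and L_nonneg: "0 \<le> L" and step_size: "\<eta> * L < 1 / 3"
    and init: "z 0 \<in> strategies" "\<And>k. 0 < coord (z 0) k"
    and init': "z' 0 \<in> strategies"
    and omwu: "omwu G \<eta> z z'"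
begin

lemma G_lipschitz:
  assumes "v \<in> strategies" "w \<in> strategies"
  shows "znorm_dual (G v - G w) \<le> L * znorm (v - w)"
  using bspec [OF bspec [OF lipschitz [unfolded lipschitz_on_strategies_def] assms(1)] assms(2)] .

lemma z_Suc: "z (Suc t) = omwu_step \<eta> (z t) (G (z' t))"
  and z'_Suc: "z' (Suc t) = omwu_step \<eta> (z (Suc t)) (G (z' t))"
  using omwu by (auto simp: omwu_def)

lemma z_strategies: "z t \<in> strategies"
  by (induction t) (simp_all only: init z_Suc omwu_step_strategies)

lemma z_pos: "0 < coord (z t) k"
proof (induction t)
  case (Suc t)
  then show ?case by (simp only: z_Suc omwu_step_pos z_strategies)
qed (rule init)

lemma z'_strategies: "z' t \<in> strategies"
  by (cases t) (simp_all only: init' z'_Suc omwu_step_strategies z_strategies)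

lemma z'_Suc_pos: "0 < coord (z' (Suc t)) k"
  by (simp only: z'_Suc omwu_step_pos z_strategies z_pos)

lemma coord_z_Suc: "coord (z (Suc t)) k = coord (z t) k * growth \<eta> (z t) (G (z' t)) k"
  by (simp only: z_Suc coord_omwu_step)

lemma coord_z'_Suc:
  "coord (z' (Suc t)) k = coord (z (Suc t)) k * growth \<eta> (z (Suc t)) (G (z' t)) k"
  by (simp only: z'_Suc coord_omwu_step)

text \<open>
  The squared displacement is carried along because optimism compares the gradient at \<open>z' (Suc t)\<close>
  with the older one at \<open>z' t\<close>. The index is shifted by one because \<open>z' 0\<close> is arbitrary and not
  produced by a gradient step from \<open>z 0\<close>.
\<close>
definition potential :: "(real^'n) \<times> (real^'m) \<Rightarrow> nat \<Rightarrow> real" where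
  "potential u t = kl u (z (Suc t)) + \<eta> * L / 2 * (znorm (z (Suc t) - z' t))\<^sup>2"

lemma potential_ge_half_square:
  assumes "u \<in> strategies"
  shows "(znorm (u - z (Suc t)))\<^sup>2 / 2 \<le> potential u t"
proof -
  have "(znorm (u - z (Suc t)))\<^sup>2 / 2 \<le> kl u (z (Suc t))"
    using assms by (intro pinsker z_strategies z_pos)
  moreover have "0 \<le> \<eta> * L / 2 * (znorm (z (Suc t) - z' t))\<^sup>2"
    using eta_pos L_nonneg by simp
  ultimately show ?thesis unfolding potential_def by linarith
qed

lemma potential_nonneg: "u \<in> strategies \<Longrightarrow> 0 \<le> potential u t"
  using potential_ge_half_square [of u t] zero_le_power2 [of "znorm (u - z (Suc t))"] by linarith

text \<open>
  The three-point identity is used twice: for the real step from \<open>z (Suc t)\<close> to \<open>z (Suc (Suc t))\<close>,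
  compared with \<open>u\<close>, and for the optimistic step to \<open>z' (Suc t)\<close>, compared with
  \<open>z (Suc (Suc t))\<close>. The sum leaves two negative divergences and the product of
  \<open>G (z' (Suc t)) - G (z' t)\<close> with a displacement. With \<open>c = \<eta> * L\<close> that product costs at most
  \<open>c * ((b + a) * d)\<close>, where \<open>a\<close> is the old displacement, paid by the old potential, and \<open>b\<close>, \<open>d\<close>
  are the new ones, paid by the divergences. The quadratic \<open>d\<^sup>2\<close> is charged \<open>c\<close> here and another
  \<open>c / 2\<close> by the new potential, whence the coefficient \<open>1 / 2 - 3 / 2 * c\<close>.
\<close>
lemma potential_descent:
  assumes u: "u \<in> strategies"
  shows "potential u (Suc t) + (1 / 2 - 3 / 2 * (\<eta> * L)) *
           ((znorm (z' (Suc t) - z (Suc t)))\<^sup>2 + (znorm (z (Suc (Suc t)) - z' (Suc t)))\<^sup>2)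
         \<le> potential u t - \<eta> * (G (z' (Suc t)) \<bullet> (z' (Suc t) - u))"
proof -
  let ?x = "z (Suc t)" and ?y = "z' (Suc t)" and ?w = "z (Suc (Suc t))"
  let ?g = "G (z' (Suc t))" and ?h = "G (z' t)"
  define a b d where "a = znorm (?x - z' t)" and "b = znorm (?y - ?x)" and "d = znorm (?w - ?y)"
  define c where "c = \<eta> * L"
  have c: "0 \<le> c" using eta_pos L_nonneg by (simp add: c_def)
  have nonneg: "0 \<le> a" "0 \<le> b" "0 \<le> d" by (simp_all add: a_def b_def d_def znorm_nonneg)
  have tp1: "\<eta> * (?g \<bullet> (?w - u)) = kl u ?x - kl u ?w - kl ?w ?x"
    unfolding z_Suc [of "Suc t"] by (intro kl_three_point z_strategies z_pos u)
  have tp2: "\<eta> * (?h \<bullet> (?y - ?w)) = kl ?w ?x - kl ?w ?y - kl ?y ?x"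
    unfolding z'_Suc [of t] by (intro kl_three_point z_strategies z_pos)
  have "b\<^sup>2 / 2 \<le> kl ?y ?x"
    unfolding b_def by (intro pinsker z_strategies z'_strategies z_pos)
  moreover have "d\<^sup>2 / 2 \<le> kl ?w ?y"
    unfolding d_def by (intro pinsker z_strategies z'_strategies z'_Suc_pos)
  moreover have "\<eta> * ((?g - ?h) \<bullet> (?y - ?w)) \<le> c * ((b + a) * d)"
  proof -
    have "(?g - ?h) \<bullet> (?y - ?w) \<le> znorm_dual (?g - ?h) * znorm (?y - ?w)"
      by (rule inner_le_znorm_dual)
    also have "\<dots> \<le> L * znorm (?y - z' t) * d"
      unfolding d_def znorm_minus_commute [of ?w ?y]
      by (intro mult_right_mono znorm_nonneg G_lipschitz z'_strategies)
    also have "\<dots> \<le> L * (b + a) * d"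
      using znorm_triangle [of "?y - ?x" "?x - z' t"] L_nonneg nonneg
      by (intro mult_right_mono mult_left_mono) (auto simp: a_def b_def)
    finally show ?thesis using eta_pos by (simp add: c_def mult.assoc)
  qed
  moreover have "c * ((b + a) * d) \<le> c * (b\<^sup>2 / 2 + a\<^sup>2 / 2 + d\<^sup>2)"
  proof (rule mult_left_mono [OF _ c])
    have "0 \<le> (b - d)\<^sup>2 + (a - d)\<^sup>2" by simp
    then show "(b + a) * d \<le> b\<^sup>2 / 2 + a\<^sup>2 / 2 + d\<^sup>2"
      by (simp add: power2_diff algebra_simps)
  qed
  moreover have "\<eta> * (?g \<bullet> (?y - u)) = \<eta> * (?g \<bullet> (?w - u)) + \<eta> * (?h \<bullet> (?y - ?w))
      + \<eta> * ((?g - ?h) \<bullet> (?y - ?w))"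
    by (simp add: inner_diff_left inner_diff_right algebra_simps)
  ultimately have "kl u ?w + d\<^sup>2 / 2 + b\<^sup>2 / 2 \<le> kl u ?x - \<eta> * (?g \<bullet> (?y - u))
      + c * (b\<^sup>2 / 2 + a\<^sup>2 / 2 + d\<^sup>2)"
    using tp1 tp2 by linarith
  moreover have "0 \<le> c * b\<^sup>2" using c by simp
  ultimately show ?thesis
    unfolding potential_def a_def [symmetric] b_def [symmetric] d_def [symmetric]
      c_def [symmetric]
    by (simp add: algebra_simps)
qed

lemma slack_nonneg: "0 \<le> (1 / 2 - 3 / 2 * (\<eta> * L)) * (x\<^sup>2 + y\<^sup>2)"
  using step_size by (intro mult_nonneg_nonneg add_nonneg_nonneg zero_le_power2) linarith

lemma potential_Suc_le:
  assumes "u \<in> strategies"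
  shows "potential u (Suc t) \<le> potential u t - \<eta> * (G (z' (Suc t)) \<bullet> (z' (Suc t) - u))"
  using potential_descent [OF assms, of t]
    slack_nonneg [of "znorm (z' (Suc t) - z (Suc t))" "znorm (z (Suc (Suc t)) - z' (Suc t))"]
  by linarith

lemma decseq_potential:
  assumes "u \<in> strategies" and "\<And>v. v \<in> strategies \<Longrightarrow> 0 \<le> G v \<bullet> (v - u)"
  shows "decseq (potential u)"
proof (rule decseq_SucI)
  fix t
  have "0 \<le> \<eta> * (G (z' (Suc t)) \<bullet> (z' (Suc t) - u))"
    using eta_pos assms(2) [OF z'_strategies] by simp
  with potential_Suc_le [OF assms(1), of t] show "potential u (Suc t) \<le> potential u t" by linarith
qed

text \<open>
  A Minty solution \<open>u\<close> makes \<open>potential u\<close> decreasing and bounded below, so its decrements, which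
  dominate the squared displacements, tend to zero.
\<close>
lemma steps_vanish:
  assumes u: "u \<in> strategies" and Minty: "\<And>v. v \<in> strategies \<Longrightarrow> 0 \<le> G v \<bullet> (v - u)"
  shows "(\<lambda>t. znorm (z' t - z t)) \<longlonglongrightarrow> 0" "(\<lambda>t. znorm (z (Suc t) - z' t)) \<longlonglongrightarrow> 0"
proof -
  let ?b = "\<lambda>t. znorm (z' (Suc t) - z (Suc t))" and ?d = "\<lambda>t. znorm (z (Suc (Suc t)) - z' (Suc t))"
  define \<alpha> where "\<alpha> = 1 / 2 - 3 / 2 * (\<eta> * L)"
  have \<alpha>: "0 < \<alpha>" using step_size unfolding \<alpha>_def by linarith
  obtain l where l: "potential u \<longlonglongrightarrow> l"
    using decseq_convergent [OF decseq_potential [OF u Minty]] potential_nonneg [OF u] by blast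
  have "(\<lambda>t. (potential u t - potential u (Suc t)) / \<alpha>) \<longlonglongrightarrow> (l - l) / \<alpha>"
    using l \<alpha> by (intro tendsto_intros LIMSEQ_Suc) auto
  then have gap: "(\<lambda>t. (potential u t - potential u (Suc t)) / \<alpha>) \<longlonglongrightarrow> 0" by simp
  have bound: "(?b t)\<^sup>2 + (?d t)\<^sup>2 \<le> (potential u t - potential u (Suc t)) / \<alpha>" for t
  proof -
    have "0 \<le> \<eta> * (G (z' (Suc t)) \<bullet> (z' (Suc t) - u))"
      using eta_pos Minty [OF z'_strategies] by simp
    then have "\<alpha> * ((?b t)\<^sup>2 + (?d t)\<^sup>2) \<le> potential u t - potential u (Suc t)"
      using potential_descent [OF u, of t] unfolding \<alpha>_def by linarith
    then show ?thesis using \<alpha> by (simp add: field_simps)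
  qed
  have vanish: "h \<longlonglongrightarrow> 0" if "\<And>t. (h t)\<^sup>2 \<le> (?b t)\<^sup>2 + (?d t)\<^sup>2" for h :: "nat \<Rightarrow> real"
  proof -
    have "(\<lambda>t. (h t)\<^sup>2) \<longlonglongrightarrow> 0"
      by (rule tendsto_sandwich [OF _ _ tendsto_const gap])
         (auto intro!: always_eventually order_trans [OF that bound])
    then show ?thesis by (rule tendsto_0_if_square_tendsto_0)
  qed
  have "?b \<longlonglongrightarrow> 0" "?d \<longlonglongrightarrow> 0" by (intro vanish; simp)+
  then show "(\<lambda>t. znorm (z' t - z t)) \<longlonglongrightarrow> 0" "(\<lambda>t. znorm (z (Suc t) - z' t)) \<longlonglongrightarrow> 0"
    by (simp_all only: LIMSEQ_imp_Suc [of "\<lambda>t. znorm (z' t - z t)"]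
        LIMSEQ_imp_Suc [of "\<lambda>t. znorm (z (Suc t) - z' t)"])
qed

lemma continuous_on_coord_G: "continuous_on strategies (\<lambda>v. coord (G v) k)"
  unfolding continuous_on_def
proof (intro ballI)
  fix w :: "(real^'n) \<times> (real^'m)" assume w: "w \<in> strategies"
  have "((\<lambda>v. L * znorm (v - w)) \<longlongrightarrow> L * 0) (at w within strategies)"
    by (intro tendsto_mult tendsto_const tendsto_znorm_0 tendsto_ident_at)
  then have lim: "((\<lambda>v. L * znorm (v - w)) \<longlongrightarrow> 0) (at w within strategies)" by simp
  have "((\<lambda>v. coord (G v) k - coord (G w) k) \<longlongrightarrow> 0) (at w within strategies)"
  proof (rule Lim_null_comparison [OF _ lim])
    show "\<forall>\<^sub>F v in at w within strategies. norm (coord (G v) k - coord (G w) k) \<le> L * znorm (v - w)"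
      unfolding eventually_at_filter
    proof (rule always_eventually, intro allI impI)
      fix v :: "(real^'n) \<times> (real^'m)" assume "v \<in> strategies"
      then have "znorm_dual (G v - G w) \<le> L * znorm (v - w)"
        using w by (rule G_lipschitz)
      then show "norm (coord (G v) k - coord (G w) k) \<le> L * znorm (v - w)"
        using coord_le_znorm_dual [of "G v - G w" k] by simp
    qed
  qed
  then show "((\<lambda>v. coord (G v) k) \<longlongrightarrow> coord (G w) k) (at w within strategies)"
    by (rule LIM_zero_cancel)
qed

lemma continuous_on_growth:
  "continuous_on (strategies \<times> strategies) (\<lambda>p. growth \<eta> (fst p) (G (snd p)) k)"
proof -
  have G: "continuous_on (strategies \<times> strategies)
      (\<lambda>p. coord (G (snd p)) k)" for k
    by (rule continuous_on_compose2 [OF continuous_on_coord_G])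
       (auto intro: continuous_intros)
  note G' = G [of "Inl _", unfolded coord_simps] G [of "Inr _", unfolded coord_simps]
  show ?thesis
    unfolding growth_def
  proof (cases k)
    case (Inl i)
    have "(\<Sum>l\<in>UNIV. fst (fst p) $ l * exp (- \<eta> * fst (G (snd p)) $ l)) \<noteq> 0"
      if "p \<in> strategies \<times> strategies" for p :: "((real^'n) \<times> (real^'m)) \<times> ((real^'n) \<times> (real^'m))"
      using that by (intro less_imp_neq [symmetric] normaliser_pos) auto
    then show "continuous_on (strategies \<times> strategies) (\<lambda>p. exp (- \<eta> * coord (G (snd p)) k) /
        (case k of Inl _ \<Rightarrow> \<Sum>l\<in>UNIV. fst (fst p) $ l * exp (- \<eta> * fst (G (snd p)) $ l)
              | Inr _ \<Rightarrow> \<Sum>l\<in>UNIV. snd (fst p) $ l * exp (- \<eta> * snd (G (snd p)) $ l)))"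
      unfolding Inl coord_simps sum.case by (intro continuous_intros G' ballI)
  next
    case (Inr j)
    have "(\<Sum>l\<in>UNIV. snd (fst p) $ l * exp (- \<eta> * snd (G (snd p)) $ l)) \<noteq> 0"
      if "p \<in> strategies \<times> strategies" for p :: "((real^'n) \<times> (real^'m)) \<times> ((real^'n) \<times> (real^'m))"
      using that by (intro less_imp_neq [symmetric] normaliser_pos) auto
    then show "continuous_on (strategies \<times> strategies) (\<lambda>p. exp (- \<eta> * coord (G (snd p)) k) /
        (case k of Inl _ \<Rightarrow> \<Sum>l\<in>UNIV. fst (fst p) $ l * exp (- \<eta> * fst (G (snd p)) $ l)
              | Inr _ \<Rightarrow> \<Sum>l\<in>UNIV. snd (fst p) $ l * exp (- \<eta> * snd (G (snd p)) $ l)))"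
      unfolding Inr coord_simps sum.case by (intro continuous_intros G' ballI)
  qed
qed

text \<open>
  The quotient of consecutive iterates is the growth factor, which is continuous up to the
  boundary; since consecutive iterates have the same limit, \<open>w\<close> is fixed by the update. In
  particular the growth factor is 1 on the support of \<open>w\<close>.
\<close>
lemma limit_growth:
  assumes vanish: "(\<lambda>t. znorm (z' t - z t)) \<longlonglongrightarrow> 0" "(\<lambda>t. znorm (z (Suc t) - z' t)) \<longlonglongrightarrow> 0"
    and r: "strict_mono r" and lim: "(\<lambda>n. z (r n)) \<longlonglongrightarrow> w" and w: "w \<in> strategies"
  shows "(\<lambda>n. z (Suc (r n))) \<longlonglongrightarrow> w"
    and "coord w k * growth \<eta> w (G w) k = coord w k"
proof -
  have null: "h \<longlonglongrightarrow> 0" if "(\<lambda>t. znorm (h t)) \<longlonglongrightarrow> 0" for h :: "nat \<Rightarrow> (real^'n) \<times> (real^'m)"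
    by (rule Lim_null_comparison [OF _ that]) (simp add: norm_le_znorm)
  note sub = LIMSEQ_subseq_LIMSEQ [OF null r, unfolded o_def]
  have lim': "(\<lambda>n. z' (r n)) \<longlonglongrightarrow> w"
    using tendsto_add [OF lim sub [OF vanish(1)]] by simp
  show lim_Suc: "(\<lambda>n. z (Suc (r n))) \<longlonglongrightarrow> w"
    using tendsto_add [OF lim' sub [OF vanish(2)]] by simp
  have "(\<lambda>n. growth \<eta> (fst (z (r n), z' (r n))) (G (snd (z (r n), z' (r n)))) k)
      \<longlonglongrightarrow> growth \<eta> (fst (w, w)) (G (snd (w, w))) k"
    by (rule continuous_on_tendsto_compose [OF continuous_on_growth])
       (use w z_strategies z'_strategies in \<open>auto intro!: tendsto_Pair lim lim' simp del: mem_Sigma_iff simp: mem_Times_iff\<close>)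
  then have "(\<lambda>n. coord (z (r n)) k * growth \<eta> (z (r n)) (G (z' (r n))) k)
      \<longlonglongrightarrow> coord w k * growth \<eta> w (G w) k"
    by (auto intro!: tendsto_mult tendsto_coord lim)
  then have "(\<lambda>n. coord (z (Suc (r n))) k) \<longlonglongrightarrow> coord w k * growth \<eta> w (G w) k"
    by (simp add: coord_z_Suc)
  then show "coord w k * growth \<eta> w (G w) k = coord w k"
    using tendsto_coord [OF lim_Suc] by (rule LIMSEQ_unique)
qed

text \<open>
  Continuity of all growth factors at once, with neighbourhoods measured in the norm that
  Pinsker's inequality controls.
\<close>
lemma growth_near:
  assumes w: "w \<in> strategies" and "0 < \<epsilon>"
  obtains \<delta> where "0 < \<delta>"
    "\<And>v v' k. v \<in> strategies \<Longrightarrow> v' \<in> strategies \<Longrightarrow> znorm (v - w) < \<delta> \<Longrightarrow> znorm (v' - w) < \<delta> \<Longrightarrow>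
      \<bar>growth \<eta> v (G v') k - growth \<eta> w (G w) k\<bar> < \<epsilon>"
proof -
  have "\<exists>\<delta>>0. \<forall>v\<in>strategies. \<forall>v'\<in>strategies. znorm (v - w) < \<delta> \<longrightarrow> znorm (v' - w) < \<delta> \<longrightarrow>
      \<bar>growth \<eta> v (G v') k - growth \<eta> w (G w) k\<bar> < \<epsilon>" for k
  proof -
    obtain d where d: "0 < d" "\<And>p. p \<in> strategies \<times> strategies \<Longrightarrow> dist p (w, w) < d \<Longrightarrow>
        dist (growth \<eta> (fst p) (G (snd p)) k) (growth \<eta> (fst (w, w)) (G (snd (w, w))) k) < \<epsilon>"
      using continuous_on_growth [of k, unfolded continuous_on_iff] w \<open>0 < \<epsilon>\<close>
      by (metis mem_Times_iff fst_conv snd_conv)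
    show ?thesis
    proof (intro exI [of _ "d / 2"] conjI ballI impI)
      fix v v' assume v: "v \<in> strategies" "v' \<in> strategies"
        and near: "znorm (v - w) < d / 2" "znorm (v' - w) < d / 2"
      have "dist (v, v') (w, w) \<le> dist v w + dist v' w"
        unfolding dist_Pair_Pair by (rule sqrt_sum_squares_le_sum) auto
      also have "\<dots> < d"
        using near norm_le_znorm [of "v - w"] norm_le_znorm [of "v' - w"] by (simp add: dist_norm)
      finally show "\<bar>growth \<eta> v (G v') k - growth \<eta> w (G w) k\<bar> < \<epsilon>"
        using d(2) [of "(v, v')"] v by (auto simp: dist_real_def mem_Times_iff)
    qed (use d in simp)
  qed
  then obtain D where D: "\<And>k. 0 < D k"
    "\<And>k v v'. v \<in> strategies \<Longrightarrow> v' \<in> strategies \<Longrightarrow> znorm (v - w) < D k \<Longrightarrow> znorm (v' - w) < D k \<Longrightarrow>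
      \<bar>growth \<eta> v (G v') k - growth \<eta> w (G w) k\<bar> < \<epsilon>"
    by metis
  have le: "Min (range D) \<le> D k" for k by simp
  show thesis
  proof (rule that [of "Min (range D)"])
    show "0 < Min (range D)" using D(1) by simp
    show "\<bar>growth \<eta> v (G v') k - growth \<eta> w (G w) k\<bar> < \<epsilon>"
      if "v \<in> strategies" "v' \<in> strategies" "znorm (v - w) < Min (range D)" "znorm (v' - w) < Min (range D)"
      for v v' k
      using that le [of k] by (intro D(2)) auto
  qed
qed

text \<open>
  This is where boundary fixed points that are not saddle points are ruled out. Let \<open>N\<close> be the set of
  coordinates with growth factor above 1 at \<open>w\<close> and \<open>S t\<close> their total mass at time \<open>t\<close>. While the
  iterates are close to \<open>w\<close>, three things hold.
  \<^item> \<open>S\<close> grows by a factor of at least \<open>1 + \<epsilon>\<close> per step. As \<open>S (Suc t) - S t\<close> tends to zero, \<open>S\<close> is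
    small.
  \<^item> The potential of \<open>w\<close> increases by at most a constant times \<open>S\<close>, because monotonicity permits
    replacing \<open>G (z' (Suc t))\<close> by \<open>G w\<close>, and \<open>- \<eta> * (G w \<bullet> (v - w))\<close> is the sum of
    \<open>coord v k * ln (growth \<eta> w (G w) k)\<close>, where only \<open>k \<in> N\<close> contributes positively.
  \<^item> Therefore \<open>potential w t - \<kappa> * S (Suc t)\<close> does not increase, for a suitable \<open>\<kappa>\<close>: the growth of
    \<open>S\<close> pays for that of the potential.
  So once the potential is small, it stays small and the iterates stay near \<open>w\<close> for ever, where \<open>S\<close>
  increases from a positive value although \<open>\<epsilon> * S\<close> is bounded by increments that tend to zero.
\<close>
lemma limit_growth_le_1:
  assumes vanish: "(\<lambda>t. znorm (z' t - z t)) \<longlonglongrightarrow> 0" "(\<lambda>t. znorm (z (Suc t) - z' t)) \<longlonglongrightarrow> 0"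
    and r: "strict_mono r" and lim: "(\<lambda>n. potential w (r n)) \<longlonglongrightarrow> 0" and w: "w \<in> strategies"
    and fixpoint: "\<And>k. coord w k * growth \<eta> w (G w) k = coord w k"
  shows "growth \<eta> w (G w) k \<le> 1"
proof (rule ccontr)
  assume "\<not> growth \<eta> w (G w) k \<le> 1"
  define R where "R = growth \<eta> w (G w)"
  define N where "N = {k. 1 < R k}"
  define S where "S t = (\<Sum>k\<in>N. coord (z t) k)" for t
  have R_pos: "0 < R k" for k unfolding R_def using w by (rule growth_pos)
  have "k \<in> N" using \<open>\<not> growth \<eta> w (G w) k \<le> 1\<close> by (simp add: N_def R_def)
  then have N: "N \<noteq> {}" by blast
  define m where "m = Min (R ` N)"
  have m: "1 < m" using N by (simp add: m_def N_def)
  have m_le: "m \<le> R k" if "k \<in> N" for k using that by (simp add: m_def)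
  \<comment> \<open>half the distance to 1, so that growth factors near \<open>w\<close> still exceed \<open>1 + \<epsilon>\<close> on \<open>N\<close>\<close>
  define \<epsilon> where "\<epsilon> = (m - 1) / 2"
  have \<epsilon>: "0 < \<epsilon>" using m by (simp add: \<epsilon>_def)
  define B where "B = (\<Sum>k\<in>UNIV. R k) + \<epsilon>"
  have R_le: "R k + \<epsilon> \<le> B" for k
    unfolding B_def using R_pos by (simp add: member_le_sum less_imp_le)
  have B: "0 < B" using R_le [of k] R_pos [of k] \<epsilon> by linarith
  obtain \<delta> where \<delta>: "0 < \<delta>"
    "\<And>v v' k. v \<in> strategies \<Longrightarrow> v' \<in> strategies \<Longrightarrow> znorm (v - w) < \<delta> \<Longrightarrow> znorm (v' - w) < \<delta> \<Longrightarrow>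
      \<bar>growth \<eta> v (G v') k - R k\<bar> < \<epsilon>"
    using growth_near [OF w \<epsilon>] unfolding R_def by metis
  \<comment> \<open>by Pinsker, a potential below \<open>\<theta>\<close> puts the iterate within \<open>\<delta> / 2\<close> of \<open>w\<close>\<close>
  define \<theta> where "\<theta> = \<delta>\<^sup>2 / 8"
  define \<kappa> where "\<kappa> = B * B / \<epsilon>"
  have \<kappa>: "0 < \<kappa>" using B \<epsilon> by (simp add: \<kappa>_def)
  have \<theta>: "0 < \<theta>" using \<delta>(1) by (simp add: \<theta>_def)
  have S_pos: "0 < S t" for t unfolding S_def using N z_pos by (intro sum_pos) auto
  have S_diff: "(\<lambda>t. S (Suc t) - S t) \<longlonglongrightarrow> 0"
  proof -
    have "(\<lambda>t. znorm (z (Suc t) - z' t) + znorm (z' t - z t)) \<longlonglongrightarrow> 0 + 0"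
      by (intro tendsto_add vanish)
    then have v: "(\<lambda>t. znorm (z (Suc t) - z' t) + znorm (z' t - z t)) \<longlonglongrightarrow> 0" by simp
    have "(\<lambda>t. coord (z (Suc t)) k - coord (z t) k) \<longlonglongrightarrow> 0" for k
    proof (rule Lim_null_comparison [OF _ v], rule always_eventually, rule allI)
      show "norm (coord (z (Suc t)) k - coord (z t) k) \<le> znorm (z (Suc t) - z' t) + znorm (z' t - z t)" for t
        using coord_le_znorm [of "z (Suc t) - z t" k]
          znorm_triangle [of "z (Suc t) - z' t" "z' t - z t"] by simp
    qed
    then have "(\<lambda>t. \<Sum>k\<in>N. coord (z (Suc t)) k - coord (z t) k) \<longlonglongrightarrow> (\<Sum>k\<in>N. 0)"
      by (intro tendsto_sum)
    then show ?thesis by (simp add: S_def sum_subtractf)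
  qed
  \<comment> \<open>the last bound controls \<open>\<kappa> * S (Suc (Suc t))\<close>, since
      \<open>S (Suc t) \<le> (S (Suc (Suc t)) - S (Suc t)) / \<epsilon>\<close> near \<open>w\<close>\<close>
  have "\<forall>\<^sub>F t in sequentially. znorm (z' (Suc t) - z (Suc t)) < \<delta> / 2 \<and> znorm (z (Suc t) - z' t) < \<delta> / 2
      \<and> \<kappa> * ((S (Suc (Suc t)) - S (Suc t)) * (1 + 1 / \<epsilon>)) < \<theta> / 2"
  proof (intro eventually_conj)
    show "\<forall>\<^sub>F t in sequentially. znorm (z' (Suc t) - z (Suc t)) < \<delta> / 2"
      using LIMSEQ_Suc [OF vanish(1)] \<delta>(1) by (intro order_tendstoD(2)) auto
    show "\<forall>\<^sub>F t in sequentially. znorm (z (Suc t) - z' t) < \<delta> / 2"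
      using vanish(2) \<delta>(1) by (intro order_tendstoD(2)) auto
    have "(\<lambda>t. \<kappa> * ((S (Suc (Suc t)) - S (Suc t)) * (1 + 1 / \<epsilon>))) \<longlonglongrightarrow> \<kappa> * (0 * (1 + 1 / \<epsilon>))"
      using LIMSEQ_Suc [OF S_diff] by (intro tendsto_intros)
    then show "\<forall>\<^sub>F t in sequentially. \<kappa> * ((S (Suc (Suc t)) - S (Suc t)) * (1 + 1 / \<epsilon>)) < \<theta> / 2"
      using \<theta> by (intro order_tendstoD(2)) auto
  qed
  then obtain T0 where T0: "\<And>t. T0 \<le> t \<Longrightarrow> znorm (z' (Suc t) - z (Suc t)) < \<delta> / 2"
    "\<And>t. T0 \<le> t \<Longrightarrow> znorm (z (Suc t) - z' t) < \<delta> / 2"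
    "\<And>t. T0 \<le> t \<Longrightarrow> \<kappa> * ((S (Suc (Suc t)) - S (Suc t)) * (1 + 1 / \<epsilon>)) < \<theta> / 2"
    unfolding eventually_sequentially by blast
  have near: "\<epsilon> * S (Suc t) \<le> S (Suc (Suc t)) - S (Suc t)
      \<and> potential w (Suc t) \<le> potential w t + B * B * S (Suc t)"
    if t: "T0 \<le> t" and pot: "potential w t < \<theta>" for t
  proof -
    have "(znorm (z (Suc t) - w))\<^sup>2 < (\<delta> / 2)\<^sup>2"
      using potential_ge_half_square [OF w, of t] pot
      by (simp add: \<theta>_def power_divide znorm_minus_commute [of w])
    then have z_near: "znorm (z (Suc t) - w) < \<delta> / 2"
      by (rule power2_less_imp_less) (use \<delta>(1) in simp)
    have near1: "\<bar>growth \<eta> (z (Suc t)) (G (z' (Suc t))) k - R k\<bar> < \<epsilon>" for k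
      using z_near T0(1) [OF t] \<delta>(1) znorm_triangle [of "z' (Suc t) - z (Suc t)" "z (Suc t) - w"]
      by (intro \<delta>(2) z_strategies z'_strategies) auto
    have near2: "\<bar>growth \<eta> (z (Suc t)) (G (z' t)) k - R k\<bar> < \<epsilon>" for k
      using z_near T0(2) [OF t] \<delta>(1) znorm_triangle [of "z' t - z (Suc t)" "z (Suc t) - w"]
      by (intro \<delta>(2) z_strategies z'_strategies) (auto simp: znorm_minus_commute [of "z' t" "z (Suc t)"])
    have "\<epsilon> * coord (z (Suc t)) k \<le> coord (z (Suc (Suc t))) k - coord (z (Suc t)) k" if "k \<in> N" for k
    proof -
      have "- (growth \<eta> (z (Suc t)) (G (z' (Suc t))) k - R k) < \<epsilon>"
        using near1 [of k] by (simp only: abs_less_iff)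
      moreover have "m = 1 + 2 * \<epsilon>" by (simp add: \<epsilon>_def field_simps)
      ultimately have "1 + \<epsilon> \<le> growth \<eta> (z (Suc t)) (G (z' (Suc t))) k"
        using m_le [OF that] by linarith
      then have "coord (z (Suc t)) k * (1 + \<epsilon>) \<le> coord (z (Suc (Suc t))) k"
        unfolding coord_z_Suc [of "Suc t"] by (intro mult_left_mono less_imp_le [OF z_pos])
      then show ?thesis by (simp add: algebra_simps)
    qed
    then have S: "\<epsilon> * S (Suc t) \<le> S (Suc (Suc t)) - S (Suc t)"
      unfolding S_def sum_distrib_left sum_subtractf [symmetric] by (intro sum_mono)
    have mono: "G w \<bullet> (z' (Suc t) - w) \<le> G (z' (Suc t)) \<bullet> (z' (Suc t) - w)"
      using monotone [OF z'_strategies w, of "Suc t"] by (simp add: inner_diff_left)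
    have "- \<eta> * (G w \<bullet> (z' (Suc t) - w)) = (\<Sum>k\<in>UNIV. (coord (z' (Suc t)) k - coord w k) * ln (R k))"
      using sum_ln_growth [OF w z'_strategies w, of "Suc t" \<eta> "G w"]
      by (simp add: R_def inner_diff_right algebra_simps)
    also have "\<dots> = (\<Sum>k\<in>UNIV. coord (z' (Suc t)) k * ln (R k))"
    proof (rule sum.cong)
      fix k
      have "coord w k = 0 \<or> R k = 1" using fixpoint [of k] by (auto simp: R_def)
      then show "(coord (z' (Suc t)) k - coord w k) * ln (R k) = coord (z' (Suc t)) k * ln (R k)"
        by auto
    qed simp
    also have "\<dots> \<le> (\<Sum>k\<in>UNIV. if k \<in> N then B * B * coord (z (Suc t)) k else 0)"
    proof (rule sum_mono)
      fix k
      show "coord (z' (Suc t)) k * ln (R k) \<le> (if k \<in> N then B * B * coord (z (Suc t)) k else 0)"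
      proof (cases "k \<in> N")
        case True
        have "coord (z' (Suc t)) k \<le> coord (z (Suc t)) k * B"
          unfolding coord_z'_Suc using near2 [of k] R_le [of k]
          by (intro mult_left_mono less_imp_le [OF z_pos]) (simp add: abs_less_iff)
        moreover have "ln (R k) \<le> B"
          using ln_le_minus_one [OF R_pos [of k]] R_le [of k] \<epsilon> by linarith
        moreover have "0 \<le> ln (R k)" using True by (simp add: N_def)
        ultimately have "coord (z' (Suc t)) k * ln (R k) \<le> (coord (z (Suc t)) k * B) * B"
          using z_pos [of "Suc t" k] B by (intro mult_mono) auto
        then show ?thesis using True by (simp add: mult_ac)
      next
        case False
        then have "ln (R k) \<le> 0" using R_pos [of k] by (simp add: N_def)
        then show ?thesis using False z'_Suc_pos [of t k] by (simp add: mult_nonneg_nonpos)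
      qed
    qed
    also have "\<dots> = B * B * S (Suc t)"
      by (simp add: S_def sum_distrib_left sum.If_cases)
    finally have "- \<eta> * (G w \<bullet> (z' (Suc t) - w)) \<le> B * B * S (Suc t)" .
    moreover have "\<eta> * (G w \<bullet> (z' (Suc t) - w)) \<le> \<eta> * (G (z' (Suc t)) \<bullet> (z' (Suc t) - w))"
      using mono eta_pos by simp
    ultimately have "potential w (Suc t) \<le> potential w t + B * B * S (Suc t)"
      using potential_Suc_le [OF w, of t] by linarith
    with S show ?thesis by simp
  qed
  \<comment> \<open>half of \<open>\<theta>\<close> is left for the contribution of the growing coordinates\<close>
  obtain s where s: "T0 \<le> s" "potential w s < \<theta> / 2"
  proof -
    have "\<forall>\<^sub>F n in sequentially. potential w (r n) < \<theta> / 2"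
      using lim \<theta> by (intro order_tendstoD(2)) auto
    then obtain n0 where "\<And>n. n0 \<le> n \<Longrightarrow> potential w (r n) < \<theta> / 2"
      unfolding eventually_sequentially by blast
    then show thesis
      using that [of "r (max n0 T0)"] seq_suble [OF r, of "max n0 T0"] by simp
  qed
  have stay: "potential w t < \<theta> \<and> potential w t - \<kappa> * S (Suc t) \<le> potential w s" if "s \<le> t" for t
    using that
  proof (induction t rule: dec_induct)
    case base
    then show ?case using s \<theta> \<kappa> S_pos [of "Suc s"] by simp
  next
    case (step t)
    have t: "T0 \<le> t" using s step.hyps by simp
    have grow: "\<epsilon> * S (Suc t) \<le> S (Suc (Suc t)) - S (Suc t)"
      and pot: "potential w (Suc t) \<le> potential w t + B * B * S (Suc t)"
      using near [OF t] step.IH by auto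
    have "B * B * S (Suc t) = \<kappa> * (\<epsilon> * S (Suc t))" using \<epsilon> by (simp add: \<kappa>_def)
    also have "\<dots> \<le> \<kappa> * (S (Suc (Suc t)) - S (Suc t))"
      using grow \<kappa> by (intro mult_left_mono) auto
    finally have Psi: "potential w (Suc t) - \<kappa> * S (Suc (Suc t)) \<le> potential w s"
      using pot step.IH by (simp add: right_diff_distrib)
    have "S (Suc t) \<le> (S (Suc (Suc t)) - S (Suc t)) / \<epsilon>"
      using grow \<epsilon> by (simp add: field_simps)
    then have "S (Suc (Suc t)) \<le> (S (Suc (Suc t)) - S (Suc t)) * (1 + 1 / \<epsilon>)"
      by (simp add: distrib_left)
    then have "\<kappa> * S (Suc (Suc t)) \<le> \<kappa> * ((S (Suc (Suc t)) - S (Suc t)) * (1 + 1 / \<epsilon>))"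
      using \<kappa> by (intro mult_left_mono) auto
    also have "\<dots> < \<theta> / 2" by (rule T0(3) [OF t])
    finally show ?case using Psi s(2) by simp
  qed
  have grow: "\<epsilon> * S (Suc t) \<le> S (Suc (Suc t)) - S (Suc t)" if "s \<le> t" for t
    using near [of t] stay [OF that] s that by simp
  have "S (Suc s) \<le> S (Suc t)" if "s \<le> t" for t
    using that
  proof (induction t rule: dec_induct)
    case (step t)
    have "0 \<le> \<epsilon> * S (Suc t)" using \<epsilon> S_pos [of "Suc t"] by simp
    with grow [OF step.hyps(1)] step.IH show ?case by linarith
  qed simp
  then have "\<epsilon> * S (Suc s) \<le> S (Suc (Suc t)) - S (Suc t)" if "s \<le> t" for t
    using grow [OF that] that \<epsilon> by (meson mult_left_mono less_imp_le order_trans)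
  then have "\<epsilon> * S (Suc s) \<le> 0"
    using LIMSEQ_Suc [OF S_diff] by (intro LIMSEQ_le_const) auto
  then show False using \<epsilon> S_pos [of "Suc s"] by (simp add: mult_le_0_iff)
qed

text \<open>
  At a limit point \<open>w\<close> the growth factors are 1 on the support and at most 1 elsewhere, so by
  \<open>sum_ln_growth\<close> it solves the variational inequality; monotonicity makes it a Minty solution,
  hence \<open>potential w\<close> is decreasing. Its limit is found along the subsequence that converges to \<open>w\<close>.
\<close>
theorem omwu_converges:
  assumes "u \<in> strategies" and "\<And>v. v \<in> strategies \<Longrightarrow> 0 \<le> G v \<bullet> (v - u)"
  obtains w where "w \<in> strategies" "\<And>v. v \<in> strategies \<Longrightarrow> 0 \<le> G w \<bullet> (v - w)"
    "z \<longlonglongrightarrow> w" "z' \<longlonglongrightarrow> w"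
proof -
  have vanish: "(\<lambda>t. znorm (z' t - z t)) \<longlonglongrightarrow> 0" "(\<lambda>t. znorm (z (Suc t) - z' t)) \<longlonglongrightarrow> 0"
    by (rule steps_vanish [OF assms(1)], erule assms(2))+
  have "compact (strategies :: ((real^'n) \<times> (real^'m)) set)"
    by (intro compact_Times compact_prob_simplex)
  then obtain w r where w: "w \<in> strategies" and r: "strict_mono r" and lim: "(\<lambda>n. z (r n)) \<longlonglongrightarrow> w"
    using z_strategies unfolding compact_def o_def by metis
  note lim_Suc = limit_growth(1) [OF vanish r lim w]
  note fixpoint = limit_growth(2) [OF vanish r lim w]
  have "(\<lambda>n. kl w (z (Suc (r n))) + \<eta> * L / 2 * (znorm (z (Suc (r n)) - z' (r n)))\<^sup>2)
      \<longlonglongrightarrow> 0 + \<eta> * L / 2 * 0\<^sup>2"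
    using LIMSEQ_subseq_LIMSEQ [OF vanish(2) r]
    by (intro tendsto_intros tendsto_kl_0 lim_Suc w) (simp add: o_def)
  then have pot_sub: "(\<lambda>n. potential w (r n)) \<longlonglongrightarrow> 0" by (simp add: potential_def)
  note growth_le = limit_growth_le_1 [OF vanish r pot_sub w fixpoint]
  have sol: "0 \<le> G w \<bullet> (v - w)" if v: "v \<in> strategies" for v
  proof -
    have "0 \<le> (\<Sum>k\<in>UNIV. (coord w k - coord v k) * ln (growth \<eta> w (G w) k))"
    proof (rule sum_nonneg)
      fix k
      have "coord w k = 0 \<or> growth \<eta> w (G w) k = 1" using fixpoint [of k] by auto
      moreover have "ln (growth \<eta> w (G w) k) \<le> 0"
        using growth_le [of k] growth_pos [OF w, of \<eta> "G w" k] by simp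
      ultimately show "0 \<le> (coord w k - coord v k) * ln (growth \<eta> w (G w) k)"
        using strategies_coord_nonneg [OF v, of k] by (auto simp: mult_nonneg_nonpos)
    qed
    also have "\<dots> = \<eta> * (G w \<bullet> (v - w))" by (rule sum_ln_growth [OF w w v])
    finally show ?thesis using eta_pos by (simp add: zero_le_mult_iff)
  qed
  have Minty: "0 \<le> G v \<bullet> (v - w)" if "v \<in> strategies" for v
    using sol [OF that] monotone [OF that w] by (simp add: inner_diff_left)
  obtain l where l: "potential w \<longlonglongrightarrow> l"
    using decseq_convergent [OF decseq_potential [OF w Minty]] potential_nonneg [OF w] by blast
  have pot: "potential w \<longlonglongrightarrow> 0"
    using l LIMSEQ_unique [OF LIMSEQ_subseq_LIMSEQ [OF l r, unfolded o_def] pot_sub] by simp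
  have "(\<lambda>t. (znorm (w - z (Suc t)))\<^sup>2) \<longlonglongrightarrow> 0"
  proof (rule tendsto_sandwich [OF _ _ tendsto_const])
    show "(\<lambda>t. 2 * potential w t) \<longlonglongrightarrow> 0" using tendsto_mult_left [OF pot, of 2] by simp
    show "\<forall>\<^sub>F t in sequentially. (znorm (w - z (Suc t)))\<^sup>2 \<le> 2 * potential w t"
    proof (rule always_eventually, rule allI)
      show "(znorm (w - z (Suc t)))\<^sup>2 \<le> 2 * potential w t" for t
        using potential_ge_half_square [OF w, of t] by simp
    qed
  qed simp
  then have z_dist: "(\<lambda>t. znorm (w - z (Suc t))) \<longlonglongrightarrow> 0" by (rule tendsto_0_if_square_tendsto_0)
  have "(\<lambda>t. z (Suc t) - w) \<longlonglongrightarrow> 0"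
    by (rule Lim_null_comparison [OF _ z_dist])
       (simp add: norm_le_znorm znorm_minus_commute [of w])
  then have z_lim: "z \<longlonglongrightarrow> w" by (metis LIM_zero_cancel LIMSEQ_imp_Suc)
  have "(\<lambda>t. z' t - z t) \<longlonglongrightarrow> 0"
    by (rule Lim_null_comparison [OF _ vanish(1)]) (simp add: norm_le_znorm)
  from tendsto_add [OF z_lim this] have "z' \<longlonglongrightarrow> w" by simp
  with w sol z_lim show thesis by (intro that)
qed

end

theorem theorem2:
  fixes f :: "(real^'n) \<times> (real^'m) \<Rightarrow> real"
    and g :: "(real^'n) \<times> (real^'m) \<Rightarrow> (real^'n) \<times> (real^'m)"
    and L \<eta> :: real
    and z z' :: "nat \<Rightarrow> (real^'n) \<times> (real^'m)"
  assumes "gradient_on_strategies f g"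
    and "convex_concave f"
    and "saddle_points f \<noteq> {}"
    and "lipschitz_on_strategies L (saddle_operator g)"
    and "0 < \<eta>" and "\<eta> < 1 / (3 * L)"
    and "z 0 \<in> rel_interior strategies" and "z' 0 \<in> rel_interior strategies"
    and "omwu (saddle_operator g) \<eta> z z'"
  shows "\<exists>zbar \<in> saddle_points f. z \<longlonglongrightarrow> zbar \<and> z' \<longlonglongrightarrow> zbar"
proof -
  note fg = assms(1,2)
  have "0 < 1 / (3 * L)" using assms(5,6) by linarith
  then have L: "0 < L" by (simp add: zero_less_divide_iff)
  interpret monotone_omwu "saddle_operator g" \<eta> L z z'
  proof
    show "\<eta> * L < 1 / 3" using assms(6) L by (simp add: field_simps)
  qed (use assms L saddle_operator_monotone [OF fg] rel_interior_strategies_pos [OF assms(7)]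
      rel_interior_strategies_pos [OF assms(8)] in \<open>simp_all add: less_imp_le\<close>)
  obtain u where u: "u \<in> saddle_points f" using assms(3) by blast
  then have "u \<in> strategies" by (auto simp: saddle_points_def)
  then obtain w where "w \<in> strategies" "\<And>v. v \<in> strategies \<Longrightarrow> 0 \<le> saddle_operator g w \<bullet> (v - w)"
      and "z \<longlonglongrightarrow> w" "z' \<longlonglongrightarrow> w"
    using omwu_converges saddle_point_Minty [OF fg u] by metis
  then show ?thesis using saddle_point_if_Stampacchia [OF fg] by blast
qed

end
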